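(* Let $\mathcal{H}$ be a complex Hilbert space, $A\in\mathcal{B}(\mathcal{H})$ a positive operator, $d\ge 1$ an integer, and let $\mathbb{A}$ be the $d\times d$ operator diagonal matrix on $\mathbb{H}=\oplus_{i=1}^d\mathcal{H}$ all of whose diagonal entries are $A$. Let $\mathbb{T}=(T_{ij})_{d\times d}$ be a $d\times d$ operator matrix with $T_{ij}\in\mathcal{B}_{A^{1/2}}(\mathcal{H})$ for all $i,j$, and let $\widehat{\mathbb{T}}^{\mathbb{A}}=(\|T_{ij}\|_A)_{d\times d}\in\mathbb{M}_d(\mathbb{C})$. Then $$r_{\mathbb{A}}(\mathbb{T})\leq r\left(\widehat{\mathbb{T}}^{\mathbb{A}}\right),$$ where $r(\cdot)$ is the usual spectral radius of a complex matrix.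
   Context: $\mathcal{B}(\mathcal{K})$ denotes the bounded linear operators on a complex Hilbert space $\mathcal{K}$. For a positive operator $B\in\mathcal{B}(\mathcal{K})$ put $\langle x\mid y\rangle_B=\langle Bx\mid y\rangle$ and $\|x\|_B=\langle x\mid x\rangle_B^{1/2}=\|B^{1/2}x\|$. $\mathcal{B}_{B^{1/2}}(\mathcal{K})$ is the set of $T\in\mathcal{B}(\mathcal{K})$ for which there is $\lambda>0$ with $\|Tx\|_B\le\lambda\|x\|_B$ for all $x\in\mathcal{K}$ ($B$-bounded operators). For such $T$, $\|T\|_B=\sup\{\|Tx\|_B: x\in\mathcal{K},\ \|x\|_B=1\}$ (a supremum over the empty set, occurring only if $B=0$, is $0$), and the $B$-spectral radius is $r_B(T)=\inf_{n\ge1}\|T^n\|_B^{1/n}=\lim_{n\to\infty}\|T^n\|_B^{1/n}$. The space $\mathbb{H}=\oplus_{i=1}^d\mathcal{H}$ carries the inner product $\langle x,y\rangle=\sum_{k=1}^d\langle x_k\mid y_k\rangle$; these notions are used for $(\mathcal{H},A)$ and $(\mathbb{H},\mathbb{A})$. An operator matrix with entries in $\mathcal{B}_{A^{1/2}}(\mathcal{H})$ belongs to $\mathcal{B}_{\mathbb{A}^{1/2}}(\mathbb{H})$. *)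

theory Defs
  imports "HOL-Analysis.Analysis"
begin

section \<open>Complex Hilbert spaces\<close>

class complex_vector = real_vector +
  fixes scaleC :: "complex \<Rightarrow> 'a \<Rightarrow> 'a"  (infixr "*\<^sub>C" 75)
  assumes scaleC_add_right: "a *\<^sub>C (x + y) = a *\<^sub>C x + a *\<^sub>C y"
    and scaleC_add_left: "(a + b) *\<^sub>C x = a *\<^sub>C x + b *\<^sub>C x"
    and scaleC_scaleC: "a *\<^sub>C b *\<^sub>C x = (a * b) *\<^sub>C x"
    and scaleC_one: "1 *\<^sub>C x = x"
    and scaleR_scaleC: "scaleR r x = complex_of_real r *\<^sub>C x"

text \<open>The inner product is linear in the first argument and conjugate-linear in the second.\<close>

class complex_inner = complex_vector + real_normed_vector +
  fixes cinner :: "'a \<Rightarrow> 'a \<Rightarrow> complex"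
  assumes cinner_commute: "cinner x y = cnj (cinner y x)"
    and cinner_add_left: "cinner (x + y) z = cinner x z + cinner y z"
    and cinner_scaleC_left: "cinner (c *\<^sub>C x) y = c * cinner x y"
    and cinner_ge_zero: "0 \<le> Re (cinner x x)"
    and cinner_eq_zero_iff: "cinner x x = 0 \<longleftrightarrow> x = 0"
    and norm_eq_sqrt_cinner: "norm x = sqrt (Re (cinner x x))"

class complex_hilbert = complex_inner + complete_space

instantiation complex :: complex_hilbert
begin

definition scaleC_complex_def: "c *\<^sub>C (x::complex) = c * x"
definition cinner_complex_def: "cinner (x::complex) y = x * cnj y"

instance
  by standard
    (simp_all add: scaleC_complex_def cinner_complex_def algebra_simps scaleR_conv_of_real
      cmod_def power2_eq_square)

end

text \<open>The Hilbert direct sum of copies of \<open>'a\<close>, one for each index in \<open>'n\<close>, is \<open>'a ^ 'n\<close>;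
  its library norm is already the corresponding \<open>\<ell>\<^sup>2\<close> norm.\<close>

instantiation vec :: (complex_vector, finite) complex_vector
begin

definition scaleC_vec_def: "c *\<^sub>C x = (\<chi> i. c *\<^sub>C (x $ i))"

instance
  by standard
    (simp_all add: scaleC_vec_def vec_eq_iff scaleC_add_right scaleC_add_left scaleC_scaleC
      scaleC_one scaleR_scaleC)

end

instantiation vec :: (complex_inner, finite) complex_inner
begin

definition cinner_vec_def: "cinner x y = (\<Sum>i\<in>UNIV. cinner (x $ i) (y $ i))"

instance
proof
  fix x y z :: "'a ^ 'b" and c :: complex
  show "cinner x y = cnj (cinner y x)"
    unfolding cinner_vec_def cnj_sum by (intro sum.cong refl cinner_commute)
  show "cinner (x + y) z = cinner x z + cinner y z"
    by (simp add: cinner_vec_def cinner_add_left sum.distrib)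
  show "cinner (c *\<^sub>C x) y = c * cinner x y"
    by (simp add: cinner_vec_def scaleC_vec_def cinner_scaleC_left sum_distrib_left)
  show "0 \<le> Re (cinner x x)"
    by (simp add: cinner_vec_def cinner_ge_zero sum_nonneg)
  have sq: "(norm u)\<^sup>2 = Re (cinner u u)" for u :: 'a
    by (simp add: norm_eq_sqrt_cinner cinner_ge_zero)
  show norm: "norm x = sqrt (Re (cinner x x))"
    by (simp add: norm_vec_def L2_set_def cinner_vec_def sq)
  show "cinner x x = 0 \<longleftrightarrow> x = 0"
  proof
    assume "cinner x x = 0"
    then show "x = 0" using norm by simp
  next
    assume "x = 0"
    then show "cinner x x = 0"
      using cinner_eq_zero_iff[of "0::'a"] by (simp add: cinner_vec_def)
  qed
qed

end

instance vec :: (complex_hilbert, finite) complex_hilbert ..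

section \<open>Operators and the seminorm of a positive operator\<close>

definition bounded_clinear :: "('a::complex_inner \<Rightarrow> 'a) \<Rightarrow> bool" where
  "bounded_clinear T \<longleftrightarrow> bounded_linear T \<and> (\<forall>c x. T (c *\<^sub>C x) = c *\<^sub>C T x)"

definition positive_operator :: "('a::complex_inner \<Rightarrow> 'a) \<Rightarrow> bool" where
  "positive_operator B \<longleftrightarrow>
     bounded_clinear B \<and> (\<forall>x. cinner (B x) x \<in> \<real> \<and> 0 \<le> Re (cinner (B x) x))"

definition inner_wrt :: "('a::complex_inner \<Rightarrow> 'a) \<Rightarrow> 'a \<Rightarrow> 'a \<Rightarrow> complex" where
  "inner_wrt B x y = cinner (B x) y"

text \<open>For positive \<open>B\<close> the number \<open>inner_wrt B x x\<close> is real and nonnegative.\<close>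

definition seminorm_wrt :: "('a::complex_inner \<Rightarrow> 'a) \<Rightarrow> 'a \<Rightarrow> real" where
  "seminorm_wrt B x = sqrt (Re (inner_wrt B x x))"

definition bounded_operators_wrt :: "('a::complex_inner \<Rightarrow> 'a) \<Rightarrow> ('a \<Rightarrow> 'a) set" where
  "bounded_operators_wrt B =
     {T. bounded_clinear T \<and> (\<exists>l>0. \<forall>x. seminorm_wrt B (T x) \<le> l * seminorm_wrt B x)}"

text \<open>The case distinction is needed because \<open>Sup {}\<close> is unspecified on the reals.\<close>

definition opnorm_wrt :: "('a::complex_inner \<Rightarrow> 'a) \<Rightarrow> ('a \<Rightarrow> 'a) \<Rightarrow> real" where
  "opnorm_wrt B T =
     (if {x. seminorm_wrt B x = 1} = {} then 0
      else SUP x\<in>{x. seminorm_wrt B x = 1}. seminorm_wrt B (T x))"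

definition spectral_radius_wrt :: "('a::complex_inner \<Rightarrow> 'a) \<Rightarrow> ('a \<Rightarrow> 'a) \<Rightarrow> real" where
  "spectral_radius_wrt B T = (INF n\<in>{1..}. root n (opnorm_wrt B (T ^^ n)))"

section \<open>Operator matrices and complex matrices\<close>

definition operator_matrix ::
  "('n::finite \<Rightarrow> 'n \<Rightarrow> 'a::complex_inner \<Rightarrow> 'a) \<Rightarrow> 'a ^ 'n \<Rightarrow> 'a ^ 'n" where
  "operator_matrix T x = (\<chi> i. \<Sum>j\<in>UNIV. T i j (x $ j))"

definition diagonal_operator :: "('a::complex_inner \<Rightarrow> 'a) \<Rightarrow> 'a ^ 'n::finite \<Rightarrow> 'a ^ 'n" where
  "diagonal_operator A = operator_matrix (\<lambda>i j. if i = j then A else (\<lambda>x. 0))"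

definition opnorm_matrix ::
  "('a::complex_inner \<Rightarrow> 'a) \<Rightarrow> ('n::finite \<Rightarrow> 'n \<Rightarrow> 'a \<Rightarrow> 'a) \<Rightarrow> complex ^ 'n ^ 'n" where
  "opnorm_matrix A T = (\<chi> i j. complex_of_real (opnorm_wrt A (T i j)))"

definition matrix_spectrum :: "complex ^ 'n ^ 'n \<Rightarrow> complex set" where
  "matrix_spectrum M = {z. \<not> invertible (M - mat z)}"

definition matrix_spectral_radius :: "complex ^ 'n ^ 'n \<Rightarrow> real" where
  "matrix_spectral_radius M = Max (cmod ` matrix_spectrum M)"

end

theory Submission
  imports Defs "HOL-Computational_Algebra.Fundamental_Theorem_Algebra"
begin

text \<open>Let \<open>M\<close> be the matrix of the seminorms \<open>opnorm_wrt A (T i j)\<close>. If every component of \<open>x\<close> has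
  seminorm at most \<open>1\<close>, then, by the triangle inequality and induction on \<open>n\<close>, the \<open>i\<close>-th component
  of the \<open>n\<close>-th iterate of the operator matrix at \<open>x\<close> has seminorm at most the \<open>i\<close>-th entry of
  \<open>M\<^sup>n\<close> applied to the all-ones vector. It remains to see that \<open>M\<^sup>n v = O(r\<^sup>n)\<close> whenever
  \<open>r\<close> exceeds the spectral radius of \<open>M\<close>. Some nonzero polynomial annihilates \<open>M\<close>, and one removes
  its linear factors one at a time: if the powers of \<open>M\<close> applied to \<open>w = M v - l v\<close> grow like
  \<open>r\<^sup>n\<close>, then so do those applied to \<open>v\<close>, by the recurrence \<open>M\<^sup>n\<^sup>+\<^sup>1 v = l M\<^sup>n v + M\<^sup>n w\<close> when
  \<open>\<bar>l\<bar> < r\<close>, and because \<open>M - l\<close> is invertible otherwise.\<close>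

section \<open>Growth of matrix powers\<close>

text \<open>Horner's scheme for p(M) v. The vector is built in because \<open>*\<close> on square
  matrices of this type is entrywise and not the matrix product.\<close>

definition poly_mat_vec :: "complex ^ 'n ^ 'n \<Rightarrow> complex poly \<Rightarrow> complex ^ 'n \<Rightarrow> complex ^ 'n" where
  "poly_mat_vec M p v = fold_coeffs (\<lambda>a w. a *s v + M *v w) p 0"

lemma poly_mat_vec_0 [simp]: "poly_mat_vec M 0 v = 0"
  by (simp add: poly_mat_vec_def)

lemma poly_mat_vec_pCons [simp]:
  "poly_mat_vec M (pCons a p) v = a *s v + M *v poly_mat_vec M p v"
  by (cases "p = 0 \<and> a = 0") (auto simp: poly_mat_vec_def)

lemma poly_mat_vec_add: "poly_mat_vec M (p + q) v = poly_mat_vec M p v + poly_mat_vec M q v"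
  by (induction p q rule: poly_induct2) (auto simp: algebra_simps)

lemma poly_mat_vec_sum: "poly_mat_vec M (\<Sum>i\<in>I. f i) v = (\<Sum>i\<in>I. poly_mat_vec M (f i) v)"
  by (induction I rule: infinite_finite_induct) (auto simp: poly_mat_vec_add)

lemma poly_mat_vec_smult: "poly_mat_vec M (smult c p) v = c *s poly_mat_vec M p v"
  by (induction p) (auto simp: vec.scale_right_distrib vector_scalar_commute)

lemma poly_mat_vec_diff_right: "poly_mat_vec M p (v - w) = poly_mat_vec M p v - poly_mat_vec M p w"
  by (induction p)
    (simp_all add: matrix_vector_mult_diff_distrib vec.scale_right_diff_distrib add_diff_add)

lemma poly_mat_vec_scale_right: "poly_mat_vec M p (c *s v) = c *s poly_mat_vec M p v"
  by (induction p) (auto simp: vec.scale_right_distrib vector_scalar_commute mult.commute)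

lemma poly_mat_vec_commute: "poly_mat_vec M p (M *v v) = M *v poly_mat_vec M p v"
  by (induction p) (auto simp: vector_scalar_commute matrix_vector_right_distrib)

lemma poly_mat_vec_monom: "poly_mat_vec M (monom c k) v = c *s (((*v) M ^^ k) v)"
  by (induction k) (auto simp: monom_0 monom_Suc vector_scalar_commute)

text \<open>Since q(M) commutes with M, the factor M - l can act on the vector first. This peels off
  one root in the inductions on the degree.\<close>

lemma poly_mat_vec_linear_factor:
  "poly_mat_vec M ([:- l, 1:] * q) v = poly_mat_vec M q (M *v v - l *s v)"
proof -
  have "[:- l, 1:] * q = pCons 0 q + smult (- l) q"
    by simp
  then show ?thesis
    by (simp only: poly_mat_vec_add poly_mat_vec_smult poly_mat_vec_diff_right
        poly_mat_vec_scale_right poly_mat_vec_commute poly_mat_vec_pCons) simp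
qed

lemma poly_mat_vec_eigenvector:
  assumes "M *v v = l *s v"
  shows "poly_mat_vec M p v = poly p l *s v"
  by (induction p) (auto simp: assms vector_scalar_commute vec.scale_left_distrib mult.commute)

text \<open>Iterates of \<open>M\<close> as matrices: a linear dependence among them lives in a
  finite-dimensional space and yields one polynomial for all vectors.\<close>

primrec mat_power :: "complex ^ 'n ^ 'n \<Rightarrow> nat \<Rightarrow> complex ^ 'n ^ 'n" where
  "mat_power M 0 = mat 1"
| "mat_power M (Suc n) = M ** mat_power M n"

lemma mat_power_mult_vec: "mat_power M n *v v = ((*v) M ^^ n) v"
  by (induction n) (simp_all flip: matrix_vector_mul_assoc)

text \<open>The powers of \<open>M\<close> are linearly dependent already over the reals.\<close>

lemma exists_annihilating_poly:
  fixes M :: "complex ^ 'n ^ 'n"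
  obtains p where "p \<noteq> 0" "\<And>v. poly_mat_vec M p v = 0"
proof (cases "inj_on (mat_power M) {..DIM(complex^'n^'n)}")
  \<comment> \<open>Two equal powers give the polynomial X^i - X^j directly. Linear dependence
    speaks of a set, in which such a repetition would be lost.\<close>
  case False
  then obtain i j where ij: "i \<noteq> j" "mat_power M i = mat_power M j"
    by (auto simp: inj_on_def)
  define p :: "complex poly" where "p = monom 1 i + monom (-1) j"
  have "coeff p i = 1"
    using ij(1) by (simp add: p_def)
  then have "p \<noteq> 0"
    by auto
  moreover have "poly_mat_vec M p v = 0" for v
    using ij(2) by (simp add: p_def poly_mat_vec_add poly_mat_vec_monom flip: mat_power_mult_vec)
  ultimately show ?thesis
    by (rule that)
next
  case True
  let ?N = "DIM(complex^'n^'n)"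
  \<comment> \<open>\<open>{..?N}\<close> contains \<open>?N\<close>, so there are
    \<open>?N + 1\<close> distinct powers, one more than the real dimension.\<close>
  have "dependent (mat_power M ` {..?N})"
    by (rule dependent_biggerset) (simp add: card_image[OF True] del: DIM_cart)
  then obtain u where u: "\<exists>B\<in>mat_power M ` {..?N}. u B \<noteq> 0"
      "(\<Sum>B\<in>mat_power M ` {..?N}. u B *\<^sub>R B) = 0"
    by (auto simp: real_vector.dependent_finite)
  define c where "c k = u (mat_power M k)" for k
  obtain k0 where k0: "k0 \<le> ?N" "c k0 \<noteq> 0"
    using u(1) by (auto simp: c_def)
  have sum0: "(\<Sum>k\<le>?N. c k *\<^sub>R mat_power M k) = 0"
    using u(2) by (simp add: sum.reindex[OF True] c_def del: DIM_cart)
  define p :: "complex poly" where "p = (\<Sum>k\<le>?N. monom (complex_of_real (c k)) k)"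
  have "coeff p k0 = complex_of_real (c k0)"
    using k0(1) by (simp add: p_def coeff_sum del: DIM_cart)
  then have "p \<noteq> 0"
    using k0(2) by auto
  moreover have "poly_mat_vec M p v = 0" for v
  proof -
    have scale: "complex_of_real r *s (B *v v) = (r *\<^sub>R B) *v v" for r and B :: "complex^'n^'n"
      by (simp add: vec_eq_iff matrix_vector_mult_def sum_distrib_left
          scaleR_conv_of_real[where 'a = complex] mult.assoc)
    have dist: "(\<Sum>k\<in>I. B k) *v v = (\<Sum>k\<in>I. B k *v v)" for I :: "nat set" and B :: "nat \<Rightarrow> complex^'n^'n"
      by (induction I rule: infinite_finite_induct) (auto simp: matrix_vector_mult_add_rdistrib)
    have "poly_mat_vec M p v = (\<Sum>k\<le>?N. c k *\<^sub>R mat_power M k) *v v"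
      by (simp add: p_def poly_mat_vec_sum poly_mat_vec_monom scale dist
          del: DIM_cart flip: mat_power_mult_vec)
    then show ?thesis
      by (simp add: sum0 del: DIM_cart)
  qed
  ultimately show ?thesis
    by (rule that)
qed

section \<open>Eigenvalues and the spectral radius\<close>

lemma diff_mat_mult_vec: "(M - mat z) *v v = M *v v - z *s v" for M :: "complex ^ 'n ^ 'n"
proof -
  have "mat z *v v = z *s v"
    by (simp add: vec_eq_iff matrix_vector_mult_def mat_def
        if_distrib[where f = "\<lambda>x. x * _"] cong: if_cong)
  then show ?thesis
    by (simp add: matrix_vector_mult_diff_rdistrib)
qed

text \<open>A square matrix with trivial kernel has a left inverse, which is two-sided.\<close>

lemma matrix_spectrum_iff_eigenvector:
  "z \<in> matrix_spectrum M \<longleftrightarrow> (\<exists>v. v \<noteq> 0 \<and> M *v v = z *s v)"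
  unfolding matrix_spectrum_def mem_Collect_eq invertible_left_inverse matrix_left_invertible_ker
    diff_mat_mult_vec by auto

text \<open>Every eigenvalue is a root of an annihilating polynomial. Finiteness makes the
  \<open>Max\<close> in the spectral radius an upper bound.\<close>

lemma finite_matrix_spectrum: "finite (matrix_spectrum M)"
proof -
  obtain p where p: "p \<noteq> 0" "\<And>v. poly_mat_vec M p v = 0"
    using exists_annihilating_poly[of M] by blast
  have "matrix_spectrum M \<subseteq> {z. poly p z = 0}"
    using p(2) poly_mat_vec_eigenvector[of M _ _ p]
    by (fastforce simp: matrix_spectrum_iff_eigenvector)
  then show ?thesis
    using poly_roots_finite[OF p(1)] finite_subset by blast
qed

text \<open>The case split for inductions on the degree: by the fundamental theorem of algebra a
  nonconstant polynomial has a root to split off.\<close>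

lemma complex_poly_cases:
  fixes p :: "complex poly"
  assumes "p \<noteq> 0"
  obtains c where "c \<noteq> 0" "p = [:c:]"
  | l q where "q \<noteq> 0" "degree q < degree p" "p = [:- l, 1:] * q"
proof (cases "degree p = 0")
  case True
  then show ?thesis
    using that(1) assms by (metis degree_eq_zeroE pCons_0_0)
next
  case False
  then have "\<not> constant (poly p)"
    by (simp add: constant_degree)
  then obtain l where "poly p l = 0"
    using fundamental_theorem_of_algebra by blast
  then obtain q where q: "p = [:- l, 1:] * q"
    by (auto simp: poly_eq_0_iff_dvd)
  then have "q \<noteq> 0"
    using assms by auto
  moreover have "degree p = Suc (degree q)"
    unfolding q using \<open>q \<noteq> 0\<close> by (subst degree_mult_eq) auto
  ultimately show ?thesis
    using that(2) q by auto
qed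

text \<open>Without eigenvalues every M - l is injective, hence so is p(M) for every nonzero p,
  factor by factor. An annihilating p would then force the all-ones vector to vanish.\<close>

lemma matrix_spectrum_nonempty: "matrix_spectrum M \<noteq> {}"
proof
  assume empty: "matrix_spectrum M = {}"
  have inj: "v = 0" if "p \<noteq> 0" "poly_mat_vec M p v = 0" for p v
    using that
  proof (induction "degree p" arbitrary: p v rule: less_induct)
    case less
    from less.prems(1) show ?case
    proof (cases rule: complex_poly_cases)
      case (1 c)
      then show ?thesis
        using less.prems(2) by simp
    next
      case (2 l q)
      then have "M *v v - l *s v = 0"
        using less.hyps less.prems(2) by (simp only: poly_mat_vec_linear_factor)
      then show ?thesis
        using empty matrix_spectrum_iff_eigenvector[of l M] by auto
    qed
  qed
  obtain p where "p \<noteq> 0" "\<And>v. poly_mat_vec M p v = 0"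
    using exists_annihilating_poly[of M] by blast
  then have "(1 :: complex ^ 'a) = 0"
    using inj by blast
  then show False
    by simp
qed

lemma norm_le_matrix_spectral_radius:
  "z \<in> matrix_spectrum M \<Longrightarrow> cmod z \<le> matrix_spectral_radius M"
  by (simp add: matrix_spectral_radius_def finite_matrix_spectrum)

lemma matrix_spectral_radius_nonneg: "0 \<le> matrix_spectral_radius M"
  using matrix_spectrum_nonempty[of M] norm_le_matrix_spectral_radius[of _ M]
  by (meson all_not_in_conv norm_ge_zero order_trans)

section \<open>Geometric bounds for the iterates of a matrix\<close>

lemma norm_vector_scale: "norm (c *s v) = norm c * norm v" for v :: "complex ^ 'n"
  by (simp add: norm_vec_def L2_set_right_distrib norm_mult)

lemma linear_recurrence_bound:
  fixes a :: "nat \<Rightarrow> real"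
  assumes rec: "\<And>n. a (Suc n) \<le> s * a n + C * r ^ n" and "0 \<le> s" "s < r"
  shows "\<exists>D. \<forall>n. a n \<le> D * r ^ n"
proof (intro exI allI)
  \<comment> \<open>The first entry serves \<open>n = 0\<close>; the second ensures
    \<open>C \<le> ?D * (r - s)\<close>, so that \<open>s * ?D + C \<le> ?D * r\<close>.\<close>
  let ?D = "max (a 0) (C / (r - s))"
  show "a n \<le> ?D * r ^ n" for n
  proof (induction n)
    case (Suc n)
    have "C \<le> ?D * (r - s)"
      using \<open>s < r\<close> by (simp add: pos_divide_le_eq [symmetric])
    then have "C * r ^ n \<le> (?D * (r - s)) * r ^ n"
      using assms by (intro mult_right_mono) auto
    moreover have "s * a n \<le> s * (?D * r ^ n)"
      using Suc \<open>0 \<le> s\<close> by (rule mult_left_mono)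
    ultimately have "a (Suc n) \<le> s * (?D * r ^ n) + (?D * (r - s)) * r ^ n"
      using rec[of n] by linarith
    then show ?case
      by (simp add: algebra_simps)
  qed simp
qed

text \<open>The strict inequality leaves room for Jordan blocks, which can add a factor polynomial
  in \<open>n\<close>. The constant may depend on \<open>v\<close>.\<close>

lemma matrix_power_growth:
  fixes M :: "complex ^ 'n ^ 'n"
  assumes r: "matrix_spectral_radius M < r"
  shows "\<exists>C. \<forall>n. norm (((*v) M ^^ n) v) \<le> C * r ^ n"
proof -
  have growth: "\<exists>C. \<forall>n. norm (((*v) M ^^ n) v) \<le> C * r ^ n"
    if "p \<noteq> 0" "poly_mat_vec M p v = 0" for p v
    using that
  proof (induction "degree p" arbitrary: p v rule: less_induct)
    case less
    from less.prems(1) show ?case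
    proof (cases rule: complex_poly_cases)
      case (1 c)
      then have v: "v = 0"
        using less.prems(2) by simp
      have "((*v) M ^^ n) v = 0" for n
        by (induction n) (auto simp: v)
      then show ?thesis
        by (intro exI[of _ 0]) simp
    next
      case (2 l q)
      define w where "w = M *v v - l *s v"
      \<comment> \<open>\<open>M - mat l\<close> commutes with \<open>M\<close>. Both cases below
        compare the two orbits through this identity.\<close>
      have pow_w: "((*v) M ^^ n) w = (M - mat l) *v ((*v) M ^^ n) v" for n
        by (induction n)
          (simp_all add: w_def diff_mat_mult_vec matrix_vector_mult_diff_distrib vector_scalar_commute)
      have "poly_mat_vec M q w = 0"
        using less.prems(2) 2(3) by (simp only: poly_mat_vec_linear_factor w_def)
      then obtain C where C: "\<And>n. norm (((*v) M ^^ n) w) \<le> C * r ^ n"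
        using less.hyps 2 by blast
      show ?thesis
      proof (cases "cmod l < r")
        case True
        have "norm (((*v) M ^^ Suc n) v) \<le> cmod l * norm (((*v) M ^^ n) v) + C * r ^ n" for n
        proof -
          have "((*v) M ^^ Suc n) v = l *s ((*v) M ^^ n) v + ((*v) M ^^ n) w"
            by (simp add: pow_w diff_mat_mult_vec)
          then show ?thesis
            using C[of n] norm_triangle_ineq[of "l *s ((*v) M ^^ n) v" "((*v) M ^^ n) w"]
            by (simp add: norm_vector_scale)
        qed
        then show ?thesis
          using True by (intro linear_recurrence_bound) auto
      next
        case False
        \<comment> \<open>Eigenvalues have modulus below \<open>r\<close>. Inverting
          \<open>M - mat l\<close> recovers the orbit of \<open>v\<close> from that of
          \<open>w\<close> at the cost of a constant factor.\<close>
        then have "l \<notin> matrix_spectrum M"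
          using norm_le_matrix_spectral_radius r by fastforce
        then obtain B where B: "B ** (M - mat l) = mat 1"
          by (auto simp: matrix_spectrum_def invertible_left_inverse)
        obtain K where K: "\<And>x. norm (B *v x) \<le> norm x * K" "0 < K"
          using bounded_linear.pos_bounded[OF matrix_vector_mul_bounded_linear[of B]] by blast
        have "norm (((*v) M ^^ n) v) \<le> (C * K) * r ^ n" for n
        proof -
          have "((*v) M ^^ n) v = B *v ((*v) M ^^ n) w"
            by (simp add: pow_w matrix_vector_mul_assoc B)
          then have "norm (((*v) M ^^ n) v) \<le> norm (((*v) M ^^ n) w) * K"
            using K(1) by simp
          also have "\<dots> \<le> C * r ^ n * K"
            using C K(2) by (intro mult_right_mono) auto
          finally show ?thesis
            by (simp add: mult_ac)
        qed
        then show ?thesis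
          by blast
      qed
    qed
  qed
  obtain p where "p \<noteq> 0" "\<And>v. poly_mat_vec M p v = 0"
    using exists_annihilating_poly[of M] by blast
  then show ?thesis
    using growth by blast
qed

section \<open>The seminorm of a positive operator\<close>

lemma cinner_add_right: "cinner x (y + z) = cinner x y + cinner x z"
  unfolding cinner_commute[of x] by (simp add: cinner_add_left)

lemma cinner_scaleR_left: "cinner (r *\<^sub>R x) y = complex_of_real r * cinner x y"
  by (simp add: scaleR_scaleC cinner_scaleC_left)

lemma cinner_scaleR_right: "cinner x (r *\<^sub>R y) = complex_of_real r * cinner x y"
  unfolding cinner_commute[of x] by (simp add: cinner_scaleR_left)

lemma positive_operator_bounded_linear: "positive_operator A \<Longrightarrow> bounded_linear A"
  by (simp add: positive_operator_def bounded_clinear_def)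

lemma inner_wrt_nonneg: "positive_operator A \<Longrightarrow> 0 \<le> Re (inner_wrt A x x)"
  by (simp add: positive_operator_def inner_wrt_def)

lemma seminorm_wrt_nonneg: "positive_operator A \<Longrightarrow> 0 \<le> seminorm_wrt A x"
  by (simp add: seminorm_wrt_def inner_wrt_nonneg)

lemma seminorm_wrt_scaleR:
  assumes "positive_operator A"
  shows "seminorm_wrt A (r *\<^sub>R x) = \<bar>r\<bar> * seminorm_wrt A x"
proof -
  have "Re (inner_wrt A (r *\<^sub>R x) (r *\<^sub>R x)) = r\<^sup>2 * Re (inner_wrt A x x)"
    using positive_operator_bounded_linear[OF assms]
    by (simp add: inner_wrt_def linear_simps cinner_scaleR_left cinner_scaleR_right power2_eq_square)
  then show ?thesis
    by (simp add: seminorm_wrt_def real_sqrt_mult)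
qed

lemma seminorm_wrt_0: "positive_operator A \<Longrightarrow> seminorm_wrt A 0 = 0"
  using seminorm_wrt_scaleR[of A 0 0] by simp

text \<open>The form is nonnegative on all real combinations of \<open>x\<close> and
  \<open>y\<close>; this gives a Cauchy-Schwarz bound for the mixed coefficient
  \<open>b\<close>.\<close>

lemma seminorm_wrt_triangle:
  assumes A: "positive_operator A"
  shows "seminorm_wrt A (x + y) \<le> seminorm_wrt A x + seminorm_wrt A y"
proof -
  define a where "a = Re (inner_wrt A x x)"
  define b where "b = Re (inner_wrt A x y) + Re (inner_wrt A y x)"
  define c where "c = Re (inner_wrt A y y)"
  have lin: "bounded_linear A"
    using A by (rule positive_operator_bounded_linear)
  have quad: "Re (inner_wrt A (s *\<^sub>R x + t *\<^sub>R y) (s *\<^sub>R x + t *\<^sub>R y)) = s\<^sup>2 * a + s * t * b + t\<^sup>2 * c" for s t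
    using lin by (simp add: inner_wrt_def linear_simps cinner_scaleR_left cinner_scaleR_right
        cinner_add_left cinner_add_right power2_eq_square a_def b_def c_def algebra_simps)
  have nonneg: "0 \<le> s\<^sup>2 * a + s * t * b + t\<^sup>2 * c" for s t
    unfolding quad[symmetric] using A by (rule inner_wrt_nonneg)
  have ac: "0 \<le> a" "0 \<le> c"
    using nonneg[of 1 0] nonneg[of 0 1] by simp_all
  have "b \<le> 2 * (sqrt a * sqrt c)"
  proof (cases "a = 0 \<or> c = 0")
    case True
    \<comment> \<open>If \<open>a = 0\<close>, the form at the first pair of arguments equals
      \<open>- (b * b)\<close>; if \<open>c = 0\<close>, so does the form at the second
      pair.\<close>
    then have "b * b \<le> 0"
      using nonneg[of "- (c + 1)" b] nonneg[of b "- (a + 1)"]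
      by (auto simp: power2_eq_square algebra_simps)
    then have "b = 0"
      using zero_le_square[of b] by (simp add: order_antisym)
    then show ?thesis
      using ac by simp
  next
    case False
    then have pos: "0 < sqrt a" "0 < sqrt c"
      using ac by auto
    \<comment> \<open>These weights make both square terms equal to \<open>a * c\<close>.\<close>
    have "0 \<le> (sqrt c)\<^sup>2 * a + sqrt c * (- sqrt a) * b + (- sqrt a)\<^sup>2 * c"
      by (rule nonneg)
    also have "\<dots> = (sqrt a * sqrt c) * (2 * (sqrt a * sqrt c) - b)"
      using ac by (simp add: algebra_simps power2_eq_square flip: real_sqrt_mult)
    finally have "0 \<le> 2 * (sqrt a * sqrt c) - b"
      using mult_pos_pos[OF pos] by (simp only: zero_le_mult_iff) linarith
    then show ?thesis
      by simp
  qed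
  then have "a + b + c \<le> (sqrt a + sqrt c)\<^sup>2"
    using ac by (simp add: power2_sum)
  then have "sqrt (a + b + c) \<le> sqrt a + sqrt c"
    using ac by (intro real_le_lsqrt) auto
  then show ?thesis
    using quad[of 1 1] by (simp add: seminorm_wrt_def a_def c_def)
qed

lemma seminorm_wrt_sum:
  assumes "positive_operator A"
  shows "seminorm_wrt A (\<Sum>i\<in>I. f i) \<le> (\<Sum>i\<in>I. seminorm_wrt A (f i))"
proof (induction I rule: infinite_finite_induct)
  case (insert i I)
  then show ?case
    using seminorm_wrt_triangle[OF assms, of "f i" "sum f I"] by simp
qed (simp_all add: seminorm_wrt_0[OF assms])

section \<open>Bounds for the operator seminorm\<close>

lemma opnorm_wrt_nonneg:
  assumes "bdd_above ((\<lambda>x. seminorm_wrt B (T x)) ` {x. seminorm_wrt B x = 1})"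
    and "\<And>x. 0 \<le> seminorm_wrt B x"
  shows "0 \<le> opnorm_wrt B T"
proof (cases "{x. seminorm_wrt B x = 1} = {}")
  case True
  then show ?thesis
    by (simp add: opnorm_wrt_def)
next
  case False
  then obtain x where "x \<in> {x. seminorm_wrt B x = 1}"
    by blast
  then have "seminorm_wrt B (T x) \<le> (SUP x\<in>{x. seminorm_wrt B x = 1}. seminorm_wrt B (T x))"
    using assms(1) by (rule cSUP_upper)
  then show ?thesis
    unfolding opnorm_wrt_def if_not_P[OF False] by (rule order_trans[OF assms(2)])
qed

text \<open>\<open>0 \<le> K\<close> covers an empty unit sphere, where \<open>opnorm_wrt\<close> is
  \<open>0\<close>.\<close>

lemma opnorm_wrt_bounds:
  assumes "\<And>x. seminorm_wrt B x = 1 \<Longrightarrow> seminorm_wrt B (T x) \<le> K"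
    and "\<And>x. 0 \<le> seminorm_wrt B x" "0 \<le> K"
  shows "0 \<le> opnorm_wrt B T" "opnorm_wrt B T \<le> K"
proof -
  have "bdd_above ((\<lambda>x. seminorm_wrt B (T x)) ` {x. seminorm_wrt B x = 1})"
    using assms(1) by (intro bdd_aboveI2[of _ _ K]) auto
  then show "0 \<le> opnorm_wrt B T"
    using assms(2) by (rule opnorm_wrt_nonneg)
  show "opnorm_wrt B T \<le> K"
    using assms(1,3) by (auto simp: opnorm_wrt_def intro!: cSUP_least)
qed

lemma bounded_operators_wrt_opnorm_nonneg:
  assumes "positive_operator A" "T \<in> bounded_operators_wrt A"
  shows "0 \<le> opnorm_wrt A T"
proof -
  obtain l where l: "l > 0" "\<And>x. seminorm_wrt A (T x) \<le> l * seminorm_wrt A x"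
    using assms(2) by (auto simp: bounded_operators_wrt_def)
  show ?thesis
  proof (rule opnorm_wrt_bounds(1)[of A T l])
    show "seminorm_wrt A (T x) \<le> l" if "seminorm_wrt A x = 1" for x
      using l(2)[of x] that by simp
  qed (use l(1) assms(1) in \<open>auto intro: seminorm_wrt_nonneg\<close>)
qed

text \<open>Vectors of positive seminorm are normalised. The others cannot be, but boundedness of
  \<open>T\<close> sends them to vectors of seminorm zero.\<close>

lemma seminorm_wrt_le_opnorm_wrt:
  assumes A: "positive_operator A" and T: "T \<in> bounded_operators_wrt A"
  shows "seminorm_wrt A (T x) \<le> opnorm_wrt A T * seminorm_wrt A x"
proof -
  obtain l where l: "l > 0" "\<And>x. seminorm_wrt A (T x) \<le> l * seminorm_wrt A x"
    using T by (auto simp: bounded_operators_wrt_def)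
  have lin: "bounded_linear T"
    using T by (simp add: bounded_operators_wrt_def bounded_clinear_def)
  show ?thesis
  proof (cases "seminorm_wrt A x = 0")
    case True
    then show ?thesis
      using l(2)[of x] by simp
  next
    case False
    define s where "s = seminorm_wrt A x"
    have s: "0 < s"
      using False seminorm_wrt_nonneg[OF A, of x] by (simp add: s_def)
    let ?y = "(1 / s) *\<^sub>R x"
    have y: "?y \<in> {x. seminorm_wrt A x = 1}"
      using s by (simp add: seminorm_wrt_scaleR[OF A] flip: s_def)
    have "bdd_above ((\<lambda>x. seminorm_wrt A (T x)) ` {x. seminorm_wrt A x = 1})"
    proof (rule bdd_aboveI2)
      show "seminorm_wrt A (T x) \<le> l" if "x \<in> {x. seminorm_wrt A x = 1}" for x
        using l(2)[of x] that by simp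
    qed
    then have "seminorm_wrt A (T ?y) \<le> opnorm_wrt A T"
      using y cSUP_upper[OF y] by (auto simp: opnorm_wrt_def)
    moreover have "seminorm_wrt A (T ?y) = seminorm_wrt A (T x) / s"
      using s lin by (simp add: linear_simps seminorm_wrt_scaleR[OF A])
    ultimately show ?thesis
      using s by (simp add: pos_divide_le_eq flip: s_def)
  qed
qed

lemma seminorm_wrt_diagonal_operator:
  assumes "positive_operator A"
  shows "seminorm_wrt (diagonal_operator A) x = L2_set (\<lambda>i. seminorm_wrt A (x $ i)) UNIV"
proof -
  have "diagonal_operator A x $ i = A (x $ i)" for i
    by (simp add: diagonal_operator_def operator_matrix_def
        if_distrib[where f = "\<lambda>f. f _"] cong: if_cong)
  then have "inner_wrt (diagonal_operator A) x x = (\<Sum>i\<in>UNIV. inner_wrt A (x $ i) (x $ i))"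
    by (simp add: inner_wrt_def cinner_vec_def)
  then show ?thesis
    by (simp add: seminorm_wrt_def L2_set_def inner_wrt_nonneg[OF assms])
qed

section \<open>Comparison with the matrix of operator seminorms\<close>

lemma seminorm_wrt_operator_matrix_power:
  fixes A :: "'a::complex_hilbert \<Rightarrow> 'a" and T :: "'d::finite \<Rightarrow> 'd \<Rightarrow> 'a \<Rightarrow> 'a"
  assumes A: "positive_operator A" and T: "\<And>i j. T i j \<in> bounded_operators_wrt A"
    and x: "\<And>j. seminorm_wrt A (x $ j) \<le> 1"
  shows "seminorm_wrt A ((operator_matrix T ^^ n) x $ i)
           \<le> norm (((*v) (opnorm_matrix A T) ^^ n) 1 $ i)"
proof -
  \<comment> \<open>The iterates of the all-ones vector, computed over the reals, where entries can
    be compared.\<close>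
  define u where "u = rec_nat (\<lambda>i. 1) (\<lambda>_ f i. \<Sum>j\<in>UNIV. opnorm_wrt A (T i j) * f j)"
  have u_0: "u 0 i = 1" and u_Suc: "u (Suc n) i = (\<Sum>j\<in>UNIV. opnorm_wrt A (T i j) * u n j)" for n i
    by (simp_all add: u_def)
  have nonneg: "0 \<le> opnorm_wrt A (T i j)" for i j
    using A T by (rule bounded_operators_wrt_opnorm_nonneg)
  have "((*v) (opnorm_matrix A T) ^^ n) 1 $ i = complex_of_real (u n i)" for i
    by (induction n arbitrary: i)
      (simp_all add: u_0 u_Suc matrix_vector_mult_def opnorm_matrix_def)
  moreover have "seminorm_wrt A ((operator_matrix T ^^ n) x $ i) \<le> u n i" for i
  proof (induction n arbitrary: i)
    case 0
    then show ?case
      by (simp add: u_0 x)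
  next
    case (Suc n)
    let ?y = "(operator_matrix T ^^ n) x"
    have "seminorm_wrt A ((operator_matrix T ^^ Suc n) x $ i)
            = seminorm_wrt A (\<Sum>j\<in>UNIV. T i j (?y $ j))"
      by (simp add: operator_matrix_def)
    also have "\<dots> \<le> (\<Sum>j\<in>UNIV. seminorm_wrt A (T i j (?y $ j)))"
      using A by (rule seminorm_wrt_sum)
    also have "\<dots> \<le> u (Suc n) i"
      unfolding u_Suc
      by (intro sum_mono order_trans[OF seminorm_wrt_le_opnorm_wrt[OF A T]] mult_left_mono Suc nonneg)
    finally show ?case .
  qed
  ultimately show ?thesis
    by (metis abs_ge_self norm_of_real order_trans)
qed

text \<open>Components of a unit vector have seminorm at most \<open>1\<close>, and the l2 norm of
  the image is at most the sum over its components. The factor \<open>CARD('d)\<close> disappears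
  under \<open>n\<close>-th roots in the limit.\<close>

lemma opnorm_wrt_operator_matrix_power:
  fixes A :: "'a::complex_hilbert \<Rightarrow> 'a" and T :: "'d::finite \<Rightarrow> 'd \<Rightarrow> 'a \<Rightarrow> 'a"
  assumes A: "positive_operator A" and T: "\<And>i j. T i j \<in> bounded_operators_wrt A"
  shows "0 \<le> opnorm_wrt (diagonal_operator A) (operator_matrix T ^^ n)"
    and "opnorm_wrt (diagonal_operator A) (operator_matrix T ^^ n)
           \<le> CARD('d) * norm (((*v) (opnorm_matrix A T) ^^ n) 1)"
proof -
  let ?K = "CARD('d) * norm (((*v) (opnorm_matrix A T) ^^ n) 1)"
  have "seminorm_wrt (diagonal_operator A) ((operator_matrix T ^^ n) x) \<le> ?K"
    if "seminorm_wrt (diagonal_operator A) x = 1" for x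
  proof -
    have x: "seminorm_wrt A (x $ j) \<le> 1" for j
      using member_le_L2_set[of UNIV j "\<lambda>i. seminorm_wrt A (x $ i)"] that
      by (simp add: seminorm_wrt_diagonal_operator[OF A])
    have "seminorm_wrt (diagonal_operator A) ((operator_matrix T ^^ n) x)
            \<le> (\<Sum>i\<in>UNIV. seminorm_wrt A ((operator_matrix T ^^ n) x $ i))"
      unfolding seminorm_wrt_diagonal_operator[OF A]
      by (rule L2_set_le_sum) (rule seminorm_wrt_nonneg[OF A])
    also have "\<dots> \<le> (\<Sum>i\<in>(UNIV :: 'd set). norm (((*v) (opnorm_matrix A T) ^^ n) 1))"
      by (intro sum_mono order_trans[OF seminorm_wrt_operator_matrix_power[OF A T x]]
          Finite_Cartesian_Product.norm_nth_le)
    finally show ?thesis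
      by simp
  qed
  moreover have "0 \<le> seminorm_wrt (diagonal_operator A) x" for x :: "'a ^ 'd"
    by (simp add: seminorm_wrt_diagonal_operator[OF A])
  ultimately show "0 \<le> opnorm_wrt (diagonal_operator A) (operator_matrix T ^^ n)"
    "opnorm_wrt (diagonal_operator A) (operator_matrix T ^^ n) \<le> ?K"
    using opnorm_wrt_bounds[of "diagonal_operator A" "operator_matrix T ^^ n" ?K] by auto
qed

text \<open>The infimum is at most each \<open>root n D * r\<close>, and these bounds tend to
  \<open>r\<close>.\<close>

lemma INF_root_le:
  fixes a :: "nat \<Rightarrow> real"
  assumes "\<And>n. 0 \<le> a n" "\<And>n. a n \<le> C * r ^ n" "0 < r"
  shows "(INF n\<in>{1..}. root n (a n)) \<le> r"
proof -
  \<comment> \<open>The roots tend to \<open>1\<close> only for a positive constant, and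
    \<open>C\<close> may be \<open>0\<close>.\<close>
  define D where "D = max C 1"
  have D: "0 < D"
    by (simp add: D_def)
  have "(INF n\<in>{1..}. root n (a n)) \<le> root n D * r" if n: "n \<ge> 1" for n
  proof -
    have "C * r ^ n \<le> D * r ^ n"
      using assms(3) by (intro mult_right_mono) (auto simp: D_def)
    then have "a n \<le> D * r ^ n"
      using assms(2)[of n] by linarith
    then have "root n (a n) \<le> root n (D * r ^ n)"
      using n by simp
    also have "\<dots> = root n D * r"
      using n assms(3) by (simp add: real_root_mult real_root_power_cancel)
    finally have "root n (a n) \<le> root n D * r" .
    moreover have "bdd_below ((\<lambda>n. root n (a n)) ` {1..})"
      using assms(1) by (intro bdd_belowI2[of _ 0]) simp
    ultimately show ?thesis
      using n by (intro cINF_lower2) auto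
  qed
  moreover have "(\<lambda>n. root n D * r) \<longlonglongrightarrow> 1 * r"
    using D by (intro tendsto_mult LIMSEQ_root_const tendsto_const)
  ultimately show ?thesis
    using LIMSEQ_le_const[of "\<lambda>n. root n D * r" "1 * r"] by auto
qed

theorem theorem2p1:
  fixes A :: "'a::complex_hilbert \<Rightarrow> 'a"
    and T :: "'d::finite \<Rightarrow> 'd \<Rightarrow> 'a \<Rightarrow> 'a"
  assumes "positive_operator A"
    and "\<And>i j. T i j \<in> bounded_operators_wrt A"
  shows "spectral_radius_wrt (diagonal_operator A :: 'a ^ 'd \<Rightarrow> 'a ^ 'd) (operator_matrix T)
           \<le> matrix_spectral_radius (opnorm_matrix A T)"
proof (rule dense_ge)
  \<comment> \<open>A bound by every \<open>r\<close> strictly above the spectral radius suffices,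
    and for such \<open>r\<close> the growth estimate is available.\<close>
  fix r
  assume r: "matrix_spectral_radius (opnorm_matrix A T) < r"
  then obtain C where C: "\<And>n. norm (((*v) (opnorm_matrix A T) ^^ n) 1) \<le> C * r ^ n"
    using matrix_power_growth by blast
  have "opnorm_wrt (diagonal_operator A) (operator_matrix T ^^ n) \<le> (CARD('d) * C) * r ^ n" for n
  proof -
    have "CARD('d) * norm (((*v) (opnorm_matrix A T) ^^ n) 1) \<le> CARD('d) * (C * r ^ n)"
      using C by (intro mult_left_mono) auto
    with opnorm_wrt_operator_matrix_power(2)[of A T n, OF assms] show ?thesis
      unfolding mult.assoc by (rule order_trans)
  qed
  \<comment> \<open>The spectral radius of the matrix is nonnegative, so
    \<open>0 < r\<close>.\<close>
  then show "spectral_radius_wrt (diagonal_operator A :: 'a ^ 'd \<Rightarrow> 'a ^ 'd) (operator_matrix T) \<le> r"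
    unfolding spectral_radius_wrt_def
    using opnorm_wrt_operator_matrix_power(1)[of A T, OF assms] r
      matrix_spectral_radius_nonneg[of "opnorm_matrix A T"]
    by (intro INF_root_le) auto
qed

end
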